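(* Let $\mathbb Q$ be a probability measure with a continuous density on $\mathcal Y$ and let $\delta\in(0,1)$. Among all probability measures $\mathbb P_0$ on $\mathcal Y$ such that the Radon–Nikodym derivative $\frac{d\mathbb Q}{d\mathbb P_0}$ exists and is continuous and positive almost surely, the minimum of $M(\mathbb P_0,\{\mathbb Q\},\delta)$ is obtained by choosing $\mathbb P_0=\mathbb Q$, and $M(\mathbb Q,\{\mathbb Q\},\delta)=\delta$.
   Context: $\mathcal Y\subseteq\mathbb R^k$ is the space in which the random variable $\xi$ takes values; densities are with respect to Lebesgue measure. For probability measures $\mathbb P_0,\mathbb Q$ on $\mathcal Y$ and $\delta>0$, $$M(\mathbb P_0,\{\mathbb Q\},\delta)=\sup\{\mathbb Q(A):\ A\subset\mathcal Y\text{ measurable},\ \mathbb P_0(A)\le\delta\}.$$ *)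

theory Defs
  imports "HOL-Probability.Probability"
begin

definition prob_measure_on :: "'a::topological_space set \<Rightarrow> 'a measure \<Rightarrow> bool" where
  "prob_measure_on Y P \<longleftrightarrow> prob_space P \<and> sets P = sets (restrict_space borel Y)"

definition has_continuous_density :: "'a::euclidean_space set \<Rightarrow> 'a measure \<Rightarrow> bool" where
  "has_continuous_density Y Q \<longleftrightarrow>
     (\<exists>f :: 'a \<Rightarrow> real. continuous_on Y f \<and> (\<forall>x\<in>Y. 0 \<le> f x) \<and>
        Q = density (restrict_space lborel Y) (\<lambda>x. ennreal (f x)))"

(* The constant RN_deriv is one arbitrarily chosen version of the derivative, for which pointwise
   continuity has no meaning. The condition is therefore that some version of dQ/dP0 is,
   at P0-almost every point, continuous relative to Y and positive. *)
definition has_cont_pos_RN_deriv :: "'a::t2_space set \<Rightarrow> 'a measure \<Rightarrow> 'a measure \<Rightarrow> bool" where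
  "has_cont_pos_RN_deriv Y P0 Q \<longleftrightarrow>
     (\<exists>f :: 'a \<Rightarrow> real. f \<in> borel_measurable P0 \<and> Q = density P0 (\<lambda>x. ennreal (f x)) \<and>
        (AE x in P0. continuous (at x within Y) f \<and> 0 < f x))"

(* max_prob P0 Q d is the quantity M(P0, {Q}, d) for a single measure Q. For probability measures on the
   same measurable space and d >= 0 the supremum is over a nonempty subset of [0, 1]. *)
definition max_prob :: "'a measure \<Rightarrow> 'a measure \<Rightarrow> real \<Rightarrow> real" where
  "max_prob P0 Q \<delta> = Sup {measure Q A | A. A \<in> sets P0 \<and> measure P0 A \<le> \<delta>}"

end

theory Submission
  imports Defs
begin

text \<open>
  Let \<open>Q\<close> have density \<open>f\<close> with respect to \<open>P\<close>. If \<open>P {f \<ge> 1} \<ge> \<delta>\<close>, choose \<open>A \<subseteq> {f \<ge> 1}\<close> with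
  \<open>P A = \<delta>\<close>; then \<open>Q A \<ge> P A\<close>. Otherwise choose \<open>B \<subseteq> {f < 1}\<close> with \<open>P B = 1 - \<delta>\<close>; then
  \<open>Q B \<le> P B\<close>, and the complement \<open>A\<close> of \<open>B\<close> satisfies \<open>P A = \<delta> \<le> Q A\<close>. Such sets are cut out by
  half-spaces, by the intermediate value theorem, because hyperplanes are null for \<open>Q\<close> and hence,
  as \<open>f > 0\<close>, also for \<open>P\<close>.
\<close>

text \<open>Level sets of \<open>u\<close> carry no mass, so the distribution function of
  \<open>u\<close> on \<open>S\<close> is continuous. It climbs from 0 to
  \<open>measure M S\<close>, hence takes any value \<open>c\<close> strictly between at some
  \<open>s\<close>, and the points of \<open>S\<close> with \<open>u x \<le> s\<close> form the
  required set.\<close>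

lemma (in finite_measure) subset_of_given_measure:
  fixes u :: "'a \<Rightarrow> real"
  assumes u: "u \<in> borel_measurable M"
    and null: "\<And>s. measure M {x \<in> space M. u x = s} = 0"
    and S: "S \<in> sets M" and c: "0 \<le> c" "c \<le> measure M S"
  shows "\<exists>A \<in> sets M. A \<subseteq> S \<and> measure M A = c"
proof (cases "c = 0 \<or> c = measure M S")
  case True
  then show ?thesis
    using S by (metis empty_subsetI measure_empty order_refl sets.empty_sets)
next
  case False
  \<comment> \<open>Strictness matters below: the distribution function tends to 0 and to
    \<open>measure M S\<close> but may attain neither.\<close>
  with c have c: "0 < c" "c < measure M S" by auto
  define N where "N = distr (restrict_space M S) borel u"
  have uS: "u \<in> borel_measurable (restrict_space M S)"
    using u by (rule measurable_restrict_space1)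
  have sub: "S \<subseteq> space M"
    using S by (rule sets.sets_into_space)
  have meas: "measure N B = measure M {x \<in> S. u x \<in> B}" if "B \<in> sets borel" for B
  proof -
    have "u -` B \<inter> space (restrict_space M S) = {x \<in> S. u x \<in> B}"
      using sub by (auto simp: space_restrict_space)
    then show ?thesis
      unfolding N_def using that uS S sub
      by (subst measure_distr) (auto intro!: measure_restrict_space)
  qed
  interpret R: finite_measure "restrict_space M S"
    using S sub by (intro finite_measureI)
      (simp add: space_restrict_space Int_absorb2 emeasure_restrict_space emeasure_eq_measure)
  interpret N: finite_borel_measure N
    unfolding finite_borel_measure_def finite_borel_measure_axioms_def
    using R.finite_measure_distr[OF uS] by (simp add: N_def)
  have "measure N {s} = 0" for s
  proof -
    have "measure M {x \<in> S. u x \<in> {s}} \<le> measure M {x \<in> space M. u x = s}"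
      using u sub by (intro finite_measure_mono) auto
    then show ?thesis
      using meas[of "{s}"] null[of s] by (simp add: measure_le_0_iff)
  qed
  then have cont: "isCont (cdf N) s" for s
    by (simp add: N.isCont_cdf)
  have "space N = UNIV" by (simp add: N_def)
  then have total: "measure N (space N) = measure M S"
    using meas[of UNIV] by simp
  have "eventually (\<lambda>x. cdf N x < c) at_bot"
    using N.cdf_lim_at_bot c(1) by (rule order_tendstoD(2))
  then obtain a where a: "cdf N a < c" "\<And>x. x \<le> a \<Longrightarrow> cdf N x < c"
    by (auto simp: eventually_at_bot_linorder)
  have "eventually (\<lambda>x. c < cdf N x) at_top"
    using N.cdf_lim_at_top c(2) unfolding total by (rule order_tendstoD(1))
  then obtain b where b: "\<And>x. b \<le> x \<Longrightarrow> c < cdf N x"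
    by (auto simp: eventually_at_top_linorder)
  have "a \<le> b"
    using a(2)[of b] b[of b] by linarith
  then obtain s where s: "cdf N s = c"
    using IVT[of "cdf N" a c b] a(1) b[of b] cont by auto
  have "{x \<in> S. u x \<in> {..s}} = S \<inter> {x \<in> space M. u x \<le> s}"
    using sub by auto
  also have "\<dots> \<in> sets M"
    using S u by auto
  finally have "{x \<in> S. u x \<in> {..s}} \<in> sets M" .
  then show ?thesis
    using s meas[of "{..s}"] by (intro bexI[of _ "{x \<in> S. u x \<in> {..s}}"]) (auto simp: cdf_def)
qed

lemma ex_set_measure_eq_measure_density_ge:
  fixes f u :: "'a \<Rightarrow> real"
  assumes "prob_space P" "prob_space Q"
    and f: "f \<in> borel_measurable P" and Q: "Q = density P (\<lambda>x. ennreal (f x))"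
    and u: "u \<in> borel_measurable P"
    and null: "\<And>s. measure P {x \<in> space P. u x = s} = 0"
    and \<delta>: "0 \<le> \<delta>" "\<delta> \<le> 1"
  shows "\<exists>A \<in> sets P. measure P A = \<delta> \<and> \<delta> \<le> measure Q A"
proof -
  interpret P: prob_space P by fact
  interpret Q: prob_space Q by fact
  have sets: "sets Q = sets P" and space: "space Q = space P"
    by (simp_all add: Q)
  have Q_eq: "emeasure Q A = (\<integral>\<^sup>+x. ennreal (f x) * indicator A x \<partial>P)" if "A \<in> sets P" for A
    using that f by (simp add: Q emeasure_density)
  define S where "S = {x \<in> space P. 1 \<le> f x}"
  have S: "S \<in> sets P"
    using f by (simp add: S_def)
  show ?thesis
  proof (cases "\<delta> \<le> measure P S")
    case True
    then obtain A where A: "A \<in> sets P" "A \<subseteq> S" "measure P A = \<delta>"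
      using P.subset_of_given_measure[OF u null S] \<delta> by blast
    have "emeasure P A = (\<integral>\<^sup>+x. indicator A x \<partial>P)"
      using A by simp
    also have "\<dots> \<le> emeasure Q A"
      unfolding Q_eq[OF A(1)] using A(2)
      by (intro nn_integral_mono) (auto simp: indicator_def S_def)
    finally have "measure P A \<le> measure Q A"
      by (simp add: P.emeasure_eq_measure Q.emeasure_eq_measure)
    with A show ?thesis by auto
  next
    case False
    then have "1 - \<delta> \<le> measure P (space P - S)"
      using P.prob_compl[OF S] by simp
    then obtain B where B: "B \<in> sets P" "B \<subseteq> space P - S" "measure P B = 1 - \<delta>"
      using P.subset_of_given_measure[OF u null, of "space P - S" "1 - \<delta>"] S \<delta> by auto
    \<comment> \<open>Off \<open>S\<close> the density is below 1; where \<open>f\<close> is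
      negative, \<open>ennreal\<close> truncates it to 0, so the bound by 1 persists.\<close>
    have "emeasure Q B \<le> (\<integral>\<^sup>+x. indicator B x \<partial>P)"
      unfolding Q_eq[OF B(1)] using B(2)
      by (intro nn_integral_mono) (auto simp: indicator_def S_def)
    also have "\<dots> = emeasure P B"
      using B by simp
    finally have "measure Q B \<le> measure P B"
      by (simp add: P.emeasure_eq_measure Q.emeasure_eq_measure)
    then show ?thesis
      using B P.prob_compl[OF B(1)] Q.prob_compl[of B] sets space
      by (intro bexI[of _ "space P - B"]) auto
  qed
qed

lemma measure_le_max_prob:
  assumes "prob_space Q" "A \<in> sets P" "measure P A \<le> \<delta>"
  shows "measure Q A \<le> max_prob P Q \<delta>"
  unfolding max_prob_def using assms
  \<comment> \<open>A real \<open>Sup\<close> dominates its members only for a set bounded above;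
    here 1 is a bound.\<close>
  by (intro cSup_upper bdd_aboveI[of _ 1]) (auto intro: prob_space.prob_le_1)

text \<open>On a null set of the density measure \<open>f\<close> is almost everywhere nonpositive,
  which positivity allows only on a \<open>P\<close>-null set. This carries the nullity of
  hyperplanes from \<open>Q\<close> over to \<open>P\<close>.\<close>

lemma null_set_if_density_pos:
  assumes f: "f \<in> borel_measurable P" and pos: "AE x in P. 0 < f x"
    and N: "N \<in> null_sets (density P (\<lambda>x. ennreal (f x)))"
  shows "N \<in> null_sets P"
proof -
  have "N \<in> sets P" and "AE x in P. x \<in> N \<longrightarrow> ennreal (f x) = 0"
    using N f by (auto simp: null_sets_density_iff)
  moreover have "AE x in P. x \<notin> N"
    using calculation(2) pos by eventually_elim (auto simp: ennreal_eq_0_iff)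
  ultimately show ?thesis
    by (simp add: AE_iff_null_sets)
qed

theorem theorem3p1p1:
  fixes Y :: "(real ^ 'k) set" and Q :: "(real ^ 'k) measure" and \<delta> :: real
  assumes "Y \<in> sets borel"
    and "prob_measure_on Y Q"
    and "has_continuous_density Y Q"
    and "0 < \<delta>" and "\<delta> < 1"
  shows "is_arg_min (\<lambda>P0. max_prob P0 Q \<delta>)
           (\<lambda>P0. prob_measure_on Y P0 \<and> has_cont_pos_RN_deriv Y P0 Q) Q
         \<and> max_prob Q Q \<delta> = \<delta>"
proof -
  have Q: "prob_space Q" "sets Q = sets (restrict_space borel Y)"
    using assms(2) by (auto simp: prob_measure_on_def)
  interpret Q: prob_space Q by fact
  obtain g :: "real ^ 'k \<Rightarrow> real"
    where g: "continuous_on Y g" "Q = density (restrict_space lborel Y) (\<lambda>x. ennreal (g x))"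
    using assms(3) by (auto simp: has_continuous_density_def)
  have g_meas: "(\<lambda>x. ennreal (g x)) \<in> borel_measurable (restrict_space lborel Y)"
    using borel_measurable_continuous_on_restrict[OF g(1)]
    by (intro measurable_compose[OF _ measurable_ennreal])
      (simp cong: measurable_cong_sets add: sets_restrict_space)
  \<comment> \<open>\<open>axis undefined 1\<close> is the unit vector of an arbitrary coordinate,
    so the level sets of \<open>u\<close> are parallel hyperplanes.\<close>
  define u :: "real ^ 'k \<Rightarrow> real" where "u = (\<lambda>x. x \<bullet> axis undefined 1)"
  have u_borel: "u \<in> borel_measurable borel"
    by (simp add: u_def)
  have hyper: "{x \<in> Y. u x = s} \<in> null_sets Q" for s
  proof -
    have "negligible {x :: real ^ 'k. axis undefined 1 \<bullet> x = s}"
      by (rule negligible_hyperplane) (simp add: axis_eq_0_iff)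
    then have "{x. u x = s} \<in> null_sets lebesgue"
      by (simp add: negligible_iff_null_sets u_def inner_commute)
    \<comment> \<open>Negligibility concerns completed Lebesgue measure; being Borel, the hyperplane
      is also null for \<open>lborel\<close>.\<close>
    moreover have H: "{x. u x = s} \<in> sets lborel"
      using u_borel by simp
    ultimately have "{x. u x = s} \<in> null_sets lborel"
      by (simp add: null_sets_completion_iff)
    then have null: "{x \<in> Y. u x = s} \<in> null_sets lborel"
      using assms(1) u_borel by (auto intro: null_sets_subset)
    then have "{x \<in> Y. u x = s} \<in> null_sets (restrict_space lborel Y)"
      using assms(1) by (simp add: null_sets_restrict_space)
    then show ?thesis
      unfolding g(2)
      using absolutely_continuousI_density[OF g_meas] by (auto simp: absolutely_continuous_def)
  qed
  have key: "\<exists>A \<in> sets P. measure P A = \<delta> \<and> \<delta> \<le> measure Q A"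
    if P: "prob_measure_on Y P" "has_cont_pos_RN_deriv Y P Q" for P
  proof -
    have P': "prob_space P" "sets P = sets (restrict_space borel Y)"
      using P by (auto simp: prob_measure_on_def)
    have sp: "space P = Y"
      using sets_eq_imp_space_eq[OF P'(2)] by (simp add: space_restrict_space)
    obtain f where f: "f \<in> borel_measurable P" "Q = density P (\<lambda>x. ennreal (f x))"
      "AE x in P. 0 < f x"
      using P(2) by (auto simp: has_cont_pos_RN_deriv_def)
    have u: "u \<in> borel_measurable P"
      using measurable_restrict_space1[OF u_borel] P'(2) by (simp cong: measurable_cong_sets)
    have "measure P {x \<in> space P. u x = s} = 0" for s
      using null_set_if_density_pos[OF f(1,3)] hyper[of s] unfolding f(2)[symmetric] sp
      by (auto intro: measure_eq_0_null_sets)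
    then show ?thesis
      using ex_set_measure_eq_measure_density_ge[OF P'(1) Q(1) f(1,2) u] assms(4,5) by auto
  qed
  \<comment> \<open>\<open>Q\<close> has the constant 1 as a derivative with respect to
    itself.\<close>
  have feas: "has_cont_pos_RN_deriv Y Q Q"
    unfolding has_cont_pos_RN_deriv_def by (intro exI[of _ "\<lambda>_. 1"]) (simp add: density_1)
  have lower: "\<delta> \<le> max_prob P Q \<delta>"
    if P: "prob_measure_on Y P" "has_cont_pos_RN_deriv Y P Q" for P
    using key[OF P] measure_le_max_prob[OF Q(1)] by fastforce
  \<comment> \<open>For \<open>P0 = Q\<close> the constraint itself bounds every member of the set
    by \<open>\<delta>\<close>; \<open>key\<close> shows that the set is nonempty, as
    \<open>cSup_least\<close> requires.\<close>
  have "max_prob Q Q \<delta> \<le> \<delta>"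
    unfolding max_prob_def using key[OF assms(2) feas] by (intro cSup_least) auto
  then have "max_prob Q Q \<delta> = \<delta>"
    using lower[OF assms(2) feas] by simp
  then show ?thesis
    using lower assms(2) feas by (auto simp: is_arg_min_def not_less)
qed

end
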